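(* Let $n\ge 1$, let $\alpha\in[0,\frac{\pi}{2})$, let $0\le v\le 1$, let $0<m\le M$ be real numbers, and put $h=M/m$. Let $A,B\in\mathbb{M}_n$ with $W(A),W(B)\subset S_\alpha$. (i) If $0<mI_n\le \Re(A^{-1}),\,\Re(B^{-1})\le MI_n$ (that is, both $\Re(A^{-1})$ and $\Re(B^{-1})$ lie between $mI_n$ and $MI_n$), then $$|\det(A\sharp_vB)|\le \sec^{5n}(\alpha)\,K^n(h)\,|\det(A!_vB)|.$$ (ii) If $0<mI_n\le \Re(A),\,\Re(B)\le MI_n$, then $$|\det(A\sharp_vB)|\ge \cos^{5n}(\alpha)\,K^{-n}(h)\,|\det(A\nabla_vB)|.$$
   Context: $\mathbb{M}_n$ is the algebra of $n\times n$ complex matrices, $I_n$ the identity. For $A\in\mathbb{M}_n$, $\Re A=\frac{A+A^*}{2}$ and $\Im A=\frac{A-A^*}{2i}$. Inequalities between Hermitian matrices are in the Loewner order. The numerical range is $W(A)=\{x^*Ax: x\in\mathbb{C}^n,\ x^*x=1\}$. For $\alpha\in[0,\frac{\pi}{2})$, $S_\alpha=\{z\in\mathbb{C}:\Re z>0,\ |\Im z|\le(\Re z)\tan\alpha\}$. If $W(A)\subset S_\alpha$ then $A$ is invertible, $\Re A$ is positive definite and $W(A^{-1})\subset S_\alpha$. For $A,B$ with $\Re A,\Re B$ positive definite and $v\in[0,1]$: $A\nabla_vB=(1-v)A+vB$; $A!_vB=\big((1-v)A^{-1}+vB^{-1}\big)^{-1}$; and the weighted geometric mean is $A\sharp_vB=\frac{\sin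 v\pi}{\pi}\int_0^\infty s^{v-1}(A^{-1}+sB^{-1})^{-1}\,ds$ for $0<v<1$, with $A\sharp_0B=A$ and $A\sharp_1B=B$. The Kantorovich constant is $K(h)=\frac{(h+1)^2}{4h}$, where $h=M/m\ge 1$; $K^p(h)=(K(h))^p$. *)

theory Defs
  imports "HOL-Analysis.Analysis"
begin

(* The library's inner product on complex^'n is the real one, so the sesquilinear
   form x^* y is introduced separately. *)
definition cinner_vec :: "complex^'n \<Rightarrow> complex^'n \<Rightarrow> complex" where
  "cinner_vec x y = (\<Sum>i\<in>UNIV. cnj (x $ i) * y $ i)"

definition ctranspose :: "complex^'n^'n \<Rightarrow> complex^'n^'n" where
  "ctranspose A = (\<chi> i j. cnj (A $ j $ i))"

definition hermitian_mat :: "complex^'n^'n \<Rightarrow> bool" where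
  "hermitian_mat A \<longleftrightarrow> ctranspose A = A"

definition re_mat :: "complex^'n^'n \<Rightarrow> complex^'n^'n" where
  "re_mat A = (1/2) *\<^sub>R (A + ctranspose A)"

definition pos_semidef :: "complex^'n^'n \<Rightarrow> bool" where
  "pos_semidef A \<longleftrightarrow> hermitian_mat A \<and> (\<forall>x. 0 \<le> Re (cinner_vec x (A *v x)))"

definition loewner_le :: "complex^'n^'n \<Rightarrow> complex^'n^'n \<Rightarrow> bool" (infix \<open>\<le>\<^sub>L\<close> 50) where
  "A \<le>\<^sub>L B \<longleftrightarrow> hermitian_mat A \<and> hermitian_mat B \<and> pos_semidef (B - A)"

definition numerical_range :: "complex^'n^'n \<Rightarrow> complex set" where
  "numerical_range A = {cinner_vec x (A *v x) | x. cinner_vec x x = 1}"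

definition sector :: "real \<Rightarrow> complex set" where
  "sector \<alpha> = {z. Re z > 0 \<and> \<bar>Im z\<bar> \<le> Re z * tan \<alpha>}"

definition arith_mean :: "real \<Rightarrow> complex^'n^'n \<Rightarrow> complex^'n^'n \<Rightarrow> complex^'n^'n" where
  "arith_mean v A B = (1 - v) *\<^sub>R A + v *\<^sub>R B"

definition harm_mean :: "real \<Rightarrow> complex^'n^'n \<Rightarrow> complex^'n^'n \<Rightarrow> complex^'n^'n" where
  "harm_mean v A B = matrix_inv ((1 - v) *\<^sub>R matrix_inv A + v *\<^sub>R matrix_inv B)"

(* For A and B with positive definite real parts and 0 < v < 1 the integrand is absolutely
   integrable, so the gauge integral is the usual improper integral. *)
definition geom_mean :: "real \<Rightarrow> complex^'n^'n \<Rightarrow> complex^'n^'n \<Rightarrow> complex^'n^'n" where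
  "geom_mean v A B =
     (if v = 0 then A else if v = 1 then B
      else (sin (v * pi) / pi) *\<^sub>R
        integral {0<..} (\<lambda>s. (s powr (v - 1)) *\<^sub>R matrix_inv (matrix_inv A + s *\<^sub>R matrix_inv B)))"

definition kantorovich :: "real \<Rightarrow> real" where
  "kantorovich h = (h + 1)\<^sup>2 / (4 * h)"

end

theory Submission
  imports Defs "HOL-Computational_Algebra.Fundamental_Theorem_Algebra"
begin

text \<open>
  Both inequalities compare determinants, and such a comparison follows from one between the
  quadratic forms \<open>x\<^sup>*Ax\<close>. If \<open>\<bar>x\<^sup>*Gx\<bar> \<le> k \<bar>x\<^sup>*Dx\<bar>\<close> for all \<open>x\<close>, where the
  right-hand form vanishes only at 0, then every \<open>z\<close> with \<open>Gx = z Dx\<close>, \<open>x \<noteq> 0\<close>, has modulus at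
  most \<open>k\<close>; these \<open>z\<close> are the eigenvalues of \<open>D\<^sup>-\<^sup>1G\<close>, so \<open>\<bar>det G\<bar> \<le> k\<^sup>n \<bar>det D\<bar>\<close>
  (\<open>cmod_det_le_of_quad_form_le\<close>).

  Two estimates control the form of an inverse. Write \<open>t = tan \<alpha>\<close>, so that \<open>1 + t\<^sup>2 = sec\<^sup>2 \<alpha>\<close>.
  If the numerical range of \<open>Y\<close> lies in the sector, then for every real \<open>\<tau>\<close>
  \<open>2 \<tau> \<bar>x\<bar>\<^sup>2 - \<tau>\<^sup>2 Re x\<^sup>*Yx \<le> (1 + t\<^sup>2) Re x\<^sup>*Y\<^sup>-\<^sup>1x\<close> (\<open>sectorial_inverse_lower_bound\<close>). If
  \<open>m \<le> Re Y \<le> M\<close>, then \<open>m M Re x\<^sup>*Y\<^sup>-\<^sup>1x \<le> (m + M) \<bar>x\<bar>\<^sup>2 - Re x\<^sup>*Yx\<close>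
  (\<open>re_bounded_inverse_upper_bound\<close>). Both estimates of the form of \<open>Y\<^sup>-\<^sup>1\<close> are affine in the form
  of \<open>Y\<close>. The first is, up to the factor \<open>1 + t\<^sup>2\<close>, a tangent line of the convex function \<open>1/y\<close>, the second its chord over
  \<open>[m, M]\<close>. With the right \<open>\<tau>\<close> the chord is \<open>K(M/m)\<close> times the tangent line, and this is where the
  Kantorovich constant comes from.

  Now put \<open>P = A\<^sup>-\<^sup>1\<close> and \<open>Q = B\<^sup>-\<^sup>1\<close>. The weight \<open>sin (v \<pi>) / \<pi> s\<^bsup>v-1\<^esup> / (1 + s)\<close> is a probability
  density on the half-line under which \<open>s / (1 + s)\<close> has mean \<open>v\<close>. The geometric mean
  therefore averages \<open>((P + s Q) / (1 + s))\<^sup>-\<^sup>1\<close>, and affine bounds in the form of \<open>P + s Q\<close>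
  integrate to the same bounds in the form of \<open>(1 - v) P + v Q\<close>. For the first inequality, integrate
  the chord bound and apply the tangent bound to the harmonic mean
  (\<open>quad_form_geom_le_harm\<close>); for the second, integrate the tangent bound and apply the chord bound
  to \<open>A\<close> and \<open>B\<close> (\<open>quad_form_arith_le_geom\<close>). Each comparison of real parts costs
  \<open>sec\<^sup>2 \<alpha> K(h)\<close>, and passing from real parts to moduli costs one more factor \<open>sec \<alpha>\<close>, as all means are
  again sectorial. The determinants are therefore compared with the factor \<open>sec\<^bsup>3n\<^esup> \<alpha> K\<^sup>n(h)\<close>, and \<open>sec \<alpha> \<ge> 1\<close>
  raises the exponent to \<open>5n\<close>.
\<close>

section \<open>Quadratic forms of complex matrices\<close>

definition quad_form :: "complex^'n^'n \<Rightarrow> complex^'n \<Rightarrow> complex" where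
  "quad_form A x = cinner_vec x (A *v x)"

text \<open>Real parts of sesquilinear forms are values of the real inner product of \<open>complex^'n\<close>.
  Estimates that only involve real parts can thus be proved for real-linear maps of a Euclidean space.\<close>

lemma Re_cinner_vec: "Re (cinner_vec x y) = x \<bullet> y"
  by (simp add: cinner_vec_def inner_vec_def inner_complex_def)

lemma cinner_vec_self: "cinner_vec x x = of_real ((norm x)\<^sup>2)"
  by (simp add: cinner_vec_def norm_vec_def L2_set_def sum_nonneg mult.commute complex_norm_square
      flip: of_real_power)

lemma cnj_cinner_vec: "cnj (cinner_vec x y) = cinner_vec y x"
  by (simp add: cinner_vec_def mult.commute)

lemma cinner_vec_diff_left: "cinner_vec (x - y) z = cinner_vec x z - cinner_vec y z"
  by (simp add: cinner_vec_def algebra_simps sum_subtractf)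

lemma cinner_vec_diff_right: "cinner_vec z (x - y) = cinner_vec z x - cinner_vec z y"
  by (simp add: cinner_vec_def algebra_simps sum_subtractf)

lemma cinner_vec_add_right: "cinner_vec z (x + y) = cinner_vec z x + cinner_vec z y"
  by (simp add: cinner_vec_def algebra_simps sum.distrib)

lemma cinner_vec_scale_left: "cinner_vec (c *s x) z = cnj c * cinner_vec x z"
  by (simp add: cinner_vec_def algebra_simps sum_distrib_left)

lemma cinner_vec_scale_right: "cinner_vec z (c *s x) = c * cinner_vec z x"
  by (simp add: cinner_vec_def algebra_simps sum_distrib_left)

lemma scaleR_matrix_mult_vec: "(r *\<^sub>R (A :: complex^'n^'m)) *v x = of_real r *s (A *v x)"
  by (simp add: matrix_vector_mult_def vec_eq_iff sum_distrib_left scaleR_conv_of_real[where 'a = complex] mult.assoc)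

lemma quad_form_add: "quad_form (A + B) x = quad_form A x + quad_form B x"
  by (simp add: quad_form_def matrix_vector_mult_add_rdistrib cinner_vec_add_right)

lemma quad_form_scaleR: "quad_form (r *\<^sub>R A) x = r *\<^sub>R quad_form A x"
  by (simp add: quad_form_def scaleR_matrix_mult_vec cinner_vec_scale_right scaleR_conv_of_real[where 'a = complex])

lemma quad_form_scale: "quad_form A (c *s x) = of_real ((cmod c)\<^sup>2) * quad_form A x"
  by (simp add: quad_form_def vec.scale cinner_vec_scale_left cinner_vec_scale_right complex_norm_square mult.commute flip: of_real_power)

lemma Re_quad_form: "Re (quad_form A x) = x \<bullet> (A *v x)"
  by (simp add: quad_form_def Re_cinner_vec)

lemma bounded_linear_quad_form: "bounded_linear (\<lambda>A. quad_form A x)"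
  unfolding linear_conv_bounded_linear[symmetric]
  by (rule linearI) (simp_all add: quad_form_add quad_form_scaleR)

lemma linear_matrix_vector_mult: "linear ((*v) (A :: complex^'n^'n))"
  by (rule linearI, rule matrix_vector_right_distrib)
    (simp add: vec_eq_iff matrix_vector_mult_def scaleR_sum_right)

lemma mat_mult_vec: "mat c *v x = c *s (x :: complex^'n)"
  by (simp add: vec_eq_iff matrix_vector_mult_def mat_def if_distrib if_distribR cong: if_cong)

lemma matrix_mult_inv_vec:
  fixes A :: "complex^'n^'n"
  assumes "invertible A"
  shows "A *v (matrix_inv A *v x) = x" "matrix_inv A *v (A *v x) = x"
proof -
  have "\<exists>A'. A ** A' = mat 1 \<and> A' ** A = mat 1" using assms by (simp add: invertible_def)
  then have "A ** matrix_inv A = mat 1 \<and> matrix_inv A ** A = mat 1"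
    unfolding matrix_inv_def by (rule someI_ex)
  then show "A *v (matrix_inv A *v x) = x" "matrix_inv A *v (A *v x) = x"
    by (simp_all add: matrix_vector_mul_assoc)
qed

lemma matrix_mult_axis:
  fixes A :: "complex^'n^'n"
  shows "(A *v axis j 1) $ k = A $ k $ j"
  by (simp add: matrix_vector_mult_def axis_def if_distrib cong: if_cong)

lemma quad_form_mat: "quad_form (mat c) x = c * of_real ((norm x)\<^sup>2)"
  by (simp only: quad_form_def mat_mult_vec cinner_vec_scale_right cinner_vec_self)

lemma quad_form_ctranspose: "quad_form (ctranspose A) x = cnj (quad_form A x)"
proof -
  have "quad_form (ctranspose A) x = (\<Sum>i\<in>UNIV. \<Sum>j\<in>UNIV. cnj (x $ i) * (cnj (A $ j $ i) * x $ j))"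
    by (simp add: quad_form_def cinner_vec_def ctranspose_def matrix_vector_mult_def sum_distrib_left)
  also have "\<dots> = (\<Sum>j\<in>UNIV. \<Sum>i\<in>UNIV. cnj (x $ i) * (cnj (A $ j $ i) * x $ j))"
    by (rule sum.swap)
  also have "\<dots> = cnj (quad_form A x)"
    by (simp add: quad_form_def cinner_vec_def matrix_vector_mult_def sum_distrib_left mult_ac)
  finally show ?thesis .
qed

lemma Re_quad_form_re_mat: "Re (quad_form (re_mat A) x) = Re (quad_form A x)"
  by (simp add: re_mat_def quad_form_scaleR quad_form_add quad_form_ctranspose)

lemma loewner_le_quad_form:
  assumes "A \<le>\<^sub>L B"
  shows "Re (quad_form A x) \<le> Re (quad_form B x)"
proof -
  have "0 \<le> Re (quad_form (B - A) x)"
    using assms by (simp add: loewner_le_def pos_semidef_def quad_form_def)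
  moreover have "quad_form B x = quad_form (B - A) x + quad_form A x"
    by (simp flip: quad_form_add)
  ultimately show ?thesis by simp
qed

lemma re_mat_lower_bound: "mat (of_real m) \<le>\<^sub>L re_mat A \<Longrightarrow> m * (norm x)\<^sup>2 \<le> Re (quad_form A x)"
  using loewner_le_quad_form[of "mat (of_real m)" "re_mat A" x]
  by (simp add: quad_form_mat Re_quad_form_re_mat flip: of_real_mult of_real_power)

lemma re_mat_upper_bound: "re_mat A \<le>\<^sub>L mat (of_real M) \<Longrightarrow> Re (quad_form A x) \<le> M * (norm x)\<^sup>2"
  using loewner_le_quad_form[of "re_mat A" "mat (of_real M)" x]
  by (simp add: quad_form_mat Re_quad_form_re_mat flip: of_real_mult of_real_power)

section \<open>Matrices with numerical range in a sector\<close>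

text \<open>The parameter \<open>t\<close> is the tangent of the opening angle. Quantifying over all nonzero
  vectors instead of unit vectors makes the notion visibly stable under substitution \<open>x \<mapsto>
  Y\<^sup>-\<^sup>1x\<close>.\<close>

definition sectorial :: "real \<Rightarrow> complex^'n^'n \<Rightarrow> bool" where
  "sectorial t A \<longleftrightarrow> (\<forall>x. x \<noteq> 0 \<longrightarrow> 0 < Re (quad_form A x) \<and> \<bar>Im (quad_form A x)\<bar> \<le> t * Re (quad_form A x))"

lemma sectorial_invertible:
  fixes A :: "complex^'n^'n"
  assumes "sectorial t A"
  shows "invertible A"
proof -
  have "x = 0" if "A *v x = 0" for x
  proof (rule ccontr)
    assume "x \<noteq> 0"
    then have "0 < Re (quad_form A x)" using assms by (auto simp: sectorial_def)
    then show False using that by (simp add: Re_quad_form)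
  qed
  then show ?thesis
    by (simp add: invertible_left_inverse matrix_left_invertible_ker)
qed

text \<open>With \<open>u = A\<^sup>-\<^sup>1x\<close>, \<open>x\<^sup>*A\<^sup>-\<^sup>1x = (Au)\<^sup>*u\<close>
  is the conjugate of \<open>u\<^sup>*Au\<close>. Hence inversion preserves sectors.\<close>

lemma quad_form_matrix_inv:
  fixes A :: "complex^'n^'n"
  assumes "invertible A"
  shows "quad_form (matrix_inv A) x = cnj (quad_form A (matrix_inv A *v x))"
  by (simp add: quad_form_def cnj_cinner_vec matrix_mult_inv_vec[OF assms])

lemma sectorial_nonneg:
  assumes "sectorial t A"
  shows "0 \<le> Re (quad_form A x)" "\<bar>Im (quad_form A x)\<bar> \<le> t * Re (quad_form A x)"
  using assms by (cases "x = 0"; force simp: sectorial_def quad_form_def cinner_vec_def)+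

lemma sectorial_matrix_inv:
  fixes A :: "complex^'n^'n"
  assumes "sectorial t A"
  shows "sectorial t (matrix_inv A)"
proof -
  have inv: "invertible A" using assms by (rule sectorial_invertible)
  have "matrix_inv A *v x \<noteq> 0" if "x \<noteq> 0" for x
    using that matrix_mult_inv_vec(1)[OF inv, of x] by auto
  then show ?thesis
    using assms by (auto simp: sectorial_def quad_form_matrix_inv[OF inv])
qed

lemma sectorial_add: "sectorial t A \<Longrightarrow> sectorial t B \<Longrightarrow> sectorial t (A + B)"
  unfolding sectorial_def quad_form_add
  by (smt (verit) Im_complex_div_gt_0 plus_complex.simps distrib_left)

lemma sectorial_scaleR: "0 < r \<Longrightarrow> sectorial t A \<Longrightarrow> sectorial t (r *\<^sub>R A)"
  by (auto simp: sectorial_def quad_form_scaleR abs_mult mult.left_commute)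

lemma sectorial_mono:
  assumes "sectorial t A" "t \<le> t'"
  shows "sectorial t' A"
  unfolding sectorial_def
proof (intro allI impI)
  fix x :: "complex^'a" assume "x \<noteq> 0"
  then have *: "0 < Re (quad_form A x)" "\<bar>Im (quad_form A x)\<bar> \<le> t * Re (quad_form A x)"
    using assms by (auto simp: sectorial_def)
  have "t * Re (quad_form A x) \<le> t' * Re (quad_form A x)"
    using * assms by (intro mult_right_mono) auto
  with * show "0 < Re (quad_form A x) \<and> \<bar>Im (quad_form A x)\<bar> \<le> t' * Re (quad_form A x)" by linarith
qed

lemma sectorial_of_numerical_range:
  fixes A :: "complex^'n^'n"
  assumes "numerical_range A \<subseteq> sector \<alpha>"
  shows "sectorial (tan \<alpha>) A"
  unfolding sectorial_def
proof (intro allI impI)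
  fix x :: "complex^'n" assume x: "x \<noteq> 0"
  define c where "c = complex_of_real (inverse (norm x))"
  have c: "cmod c = inverse (norm x)" unfolding c_def norm_of_real by simp
  have "cinner_vec (c *s x) (c *s x) = 1"
  proof -
    have "cinner_vec (c *s x) (c *s x) = cnj c * (c * of_real ((norm x)\<^sup>2))"
      unfolding cinner_vec_scale_left cinner_vec_scale_right cinner_vec_self[of x] by simp
    also have "\<dots> = of_real (inverse (norm x) * (inverse (norm x) * (norm x)\<^sup>2))"
      by (simp add: c_def)
    also have "inverse (norm x) * (inverse (norm x) * (norm x)\<^sup>2) = 1"
      using x by (simp add: power2_eq_square field_simps)
    finally show ?thesis by simp
  qed
  then have "quad_form A (c *s x) \<in> sector \<alpha>"
    using assms by (auto simp: numerical_range_def quad_form_def)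
  then have s: "of_real ((inverse (norm x))\<^sup>2) * quad_form A x \<in> sector \<alpha>"
    by (simp add: quad_form_scale c)
  define r where "r = (inverse (norm x))\<^sup>2"
  have "r > 0" using x by (simp add: r_def)
  then show "0 < Re (quad_form A x) \<and> \<bar>Im (quad_form A x)\<bar> \<le> tan \<alpha> * Re (quad_form A x)"
    using s by (simp add: sector_def zero_less_mult_iff abs_mult mult.assoc mult.commute flip: r_def)
qed

lemma sectorial_cmod_le:
  assumes "sectorial t A" "0 \<le> t"
  shows "cmod (quad_form A x) \<le> sqrt (1 + t\<^sup>2) * Re (quad_form A x)"
proof -
  have re: "0 \<le> Re (quad_form A x)" and im: "\<bar>Im (quad_form A x)\<bar> \<le> t * Re (quad_form A x)"
    using sectorial_nonneg[OF assms(1)] by auto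
  have "(Im (quad_form A x))\<^sup>2 \<le> (t * Re (quad_form A x))\<^sup>2"
    using im power_mono[OF im, of 2] by simp
  then have "cmod (quad_form A x) \<le> sqrt ((1 + t\<^sup>2) * (Re (quad_form A x))\<^sup>2)"
    unfolding cmod_def by (intro real_sqrt_le_mono) (simp add: algebra_simps power_mult_distrib)
  then show ?thesis using re by (simp add: real_sqrt_mult)
qed

lemma matrix_inv_matrix_inv:
  fixes A :: "complex^'n^'n"
  assumes "sectorial t A"
  shows "matrix_inv (matrix_inv A) = A"
proof -
  have inv: "invertible A" "invertible (matrix_inv A)"
    using assms sectorial_matrix_inv sectorial_invertible by blast+
  have "matrix_inv (matrix_inv A) *v x = A *v x" for x
    using matrix_mult_inv_vec(1)[OF inv(1), of "matrix_inv (matrix_inv A) *v x"]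
    by (simp add: matrix_mult_inv_vec(1)[OF inv(2)])
  then show ?thesis by (simp add: matrix_eq)
qed

lemma sectorial_arith_mean:
  assumes "sectorial t A" "sectorial t B" "0 \<le> v" "v \<le> 1"
  shows "sectorial t (arith_mean v A B)"
proof -
  consider "v = 0 \<or> v = 1" | "0 < v" "v < 1" using assms by linarith
  then show ?thesis
  proof cases
    case 1
    then show ?thesis using assms by (auto simp: arith_mean_def)
  next
    case 2
    then show ?thesis unfolding arith_mean_def by (intro sectorial_add sectorial_scaleR assms) auto
  qed
qed

lemma quad_form_arith_mean:
  "Re (quad_form (arith_mean v A B) x) = (1 - v) * Re (quad_form A x) + v * Re (quad_form B x)"
  by (simp add: arith_mean_def quad_form_add quad_form_scaleR)

section \<open>Tangent and chord bounds for the inverse\<close>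

text \<open>This is the inequality \<open>2 Re \<langle>w, Yu\<rangle> \<le> \<dots>\<close> that follows from a
  Cauchy-Schwarz inequality with constant \<open>sec \<alpha>\<close>. Write \<open>Y = H + iK\<close> with
  Hermitian \<open>H, K\<close>. Being sectorial means that \<open>tH + K\<close> and \<open>tH - K\<close> are
  positive semidefinite. Then \<open>2tY = (1 + it)(tH + K) + (1 - it)(tH - K)\<close>, so testing the first form
  at \<open>w - (1 + it)u\<close> and the second at \<open>w - (1 - it)u\<close> makes the mixed terms add up to a
  multiple of \<open>Re \<langle>w, Yu\<rangle>\<close>.\<close>

lemma sectorial_real_part_young_pos:
  assumes "sectorial t Y" "0 < t"
  shows "2 * (w \<bullet> (Y *v u)) \<le> w \<bullet> (Y *v w) + (1 + t\<^sup>2) * (u \<bullet> (Y *v u))"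
proof -
  define a b c d where "a = cinner_vec w (Y *v w)" and "b = cinner_vec w (Y *v u)"
    and "c = cinner_vec u (Y *v w)" and "d = cinner_vec u (Y *v u)"
  have q: "quad_form Y (w - k *s u) = a - k * b - cnj k * c + k * cnj k * d" for k
    by (simp add: quad_form_def matrix_vector_mult_diff_distrib vec.scale cinner_vec_diff_left
        cinner_vec_diff_right cinner_vec_scale_left cinner_vec_scale_right a_def b_def c_def d_def
        algebra_simps)
  have "0 \<le> t * Re (quad_form Y (w - Complex 1 t *s u)) + Im (quad_form Y (w - Complex 1 t *s u))"
    "0 \<le> t * Re (quad_form Y (w - Complex 1 (-t) *s u)) - Im (quad_form Y (w - Complex 1 (-t) *s u))"
    using sectorial_nonneg[OF assms(1), of "w - Complex 1 t *s u"]
      sectorial_nonneg[OF assms(1), of "w - Complex 1 (-t) *s u"] by linarith+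
  then have "0 \<le> 2 * t * (Re a + (1 + t\<^sup>2) * Re d - 2 * Re b)"
    unfolding q by (simp add: algebra_simps power2_eq_square)
  then have "0 \<le> Re a + (1 + t\<^sup>2) * Re d - 2 * Re b"
    using assms(2) by (simp add: zero_le_mult_iff)
  then show ?thesis by (simp add: a_def b_def d_def Re_cinner_vec)
qed

text \<open>The preceding argument divides by \<open>t\<close>; the case \<open>t = 0\<close> follows by widening
  the sector slightly and passing to the limit.\<close>

lemma sectorial_real_part_young:
  assumes "sectorial t Y" "0 \<le> t"
  shows "2 * (w \<bullet> (Y *v u)) \<le> w \<bullet> (Y *v w) + (1 + t\<^sup>2) * (u \<bullet> (Y *v u))"
proof (rule tendsto_lowerbound)
  show "((\<lambda>s. w \<bullet> (Y *v w) + (1 + s\<^sup>2) * (u \<bullet> (Y *v u))) \<longlongrightarrow>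
      w \<bullet> (Y *v w) + (1 + t\<^sup>2) * (u \<bullet> (Y *v u))) (at_right t)"
    by (intro tendsto_intros)
  show "\<forall>\<^sub>F s in at_right t. 2 * (w \<bullet> (Y *v u)) \<le> w \<bullet> (Y *v w) + (1 + s\<^sup>2) * (u \<bullet> (Y *v u))"
    using eventually_at_right_less[of t]
  proof eventually_elim
    case (elim s)
    then show ?case
      using assms sectorial_mono[OF assms(1), of s] by (intro sectorial_real_part_young_pos) auto
  qed
qed simp

text \<open>The tangent bound: for a positive number \<open>y\<close> and \<open>t = 0\<close> it says
  \<open>2\<tau> - \<tau>\<^sup>2 y \<le> 1/y\<close>, with equality at \<open>\<tau> = 1/y\<close>. In general it
  is the previous inequality for \<open>w = \<tau>x\<close> and \<open>u = Y\<^sup>-\<^sup>1x\<close>.\<close>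

lemma sectorial_inverse_lower_bound:
  fixes Y :: "complex^'n^'n"
  assumes "sectorial t Y" "0 \<le> t"
  shows "2 * \<tau> * (norm x)\<^sup>2 - \<tau>\<^sup>2 * Re (quad_form Y x) \<le> (1 + t\<^sup>2) * Re (quad_form (matrix_inv Y) x)"
proof -
  have inv: "invertible Y" using assms(1) by (rule sectorial_invertible)
  define u where "u = matrix_inv Y *v x"
  have x: "Y *v u = x" by (simp add: u_def matrix_mult_inv_vec[OF inv])
  have "2 * ((\<tau> *\<^sub>R x) \<bullet> x) \<le> (\<tau> *\<^sub>R x) \<bullet> (Y *v (\<tau> *\<^sub>R x)) + (1 + t\<^sup>2) * (u \<bullet> x)"
    using sectorial_real_part_young[OF assms, of "\<tau> *\<^sub>R x" u] unfolding x .
  moreover have "u \<bullet> x = Re (quad_form (matrix_inv Y) x)"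
    by (simp add: Re_quad_form u_def inner_commute)
  ultimately show ?thesis
    unfolding power2_norm_eq_inner Re_quad_form
    by (simp add: linear_scale[OF linear_matrix_vector_mult] power2_eq_square algebra_simps)
qed

text \<open>Let \<open>h\<close> be the self-adjoint part of \<open>f\<close>. Passing from \<open>f\<close> to
  \<open>h\<close> only increases the form of the inverse: if \<open>h y = f u\<close>, then \<open>0 \<le> (u - y)
  \<bullet> h (u - y) = y \<bullet> h y - u \<bullet> f u\<close>. For \<open>h\<close> the claim is positivity of
  \<open>h (h - m) (M - h)\<close>. With \<open>Z = h - m\<close> and \<open>c = M - m\<close> this operator is
  \<open>Z (c - Z) Z + m Z (c - Z)\<close>. The first summand is clearly positive; for the second one needs
  \<open>Z\<^sup>2 \<le> c Z\<close>, which follows from \<open>0 \<le> Z \<le> c\<close> because \<open>(c - Z) Z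
  (c - Z) + Z (c - Z) Z = c (c Z - Z\<^sup>2)\<close>.\<close>

lemma linear_kantorovich_bound:
  fixes f :: "'a::euclidean_space \<Rightarrow> 'a"
  assumes f: "linear f" and m: "0 < m" and mM: "m \<le> M"
    and lower: "\<And>x. m * (x \<bullet> x) \<le> x \<bullet> f x" and upper: "\<And>x. x \<bullet> f x \<le> M * (x \<bullet> x)"
  shows "m * M * (u \<bullet> f u) \<le> (m + M) * (f u \<bullet> f u) - f u \<bullet> f (f u)"
proof -
  define h where "h = (\<lambda>x. (1/2) *\<^sub>R (f x + adjoint f x))"
  have h: "linear h"
    unfolding h_def by (intro linear_compose_scale_right linear_compose_add f adjoint_linear)
  have sym: "h x \<bullet> y = x \<bullet> h y" for x y
    by (simp add: h_def adjoint_works[OF f] inner_add inner_commute)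
  have hf: "x \<bullet> h x = x \<bullet> f x" for x
    by (simp add: h_def adjoint_works[OF f] inner_add inner_commute)
  note hl = linear_add[OF h] linear_diff[OF h] linear_scale[OF h]
  have ker: "x = 0" if "h x = 0" for x
  proof -
    have "m * (x \<bullet> x) \<le> 0" using lower[of x] hf[of x] that by simp
    then have "x \<bullet> x \<le> 0" using m by (simp add: mult_le_0_iff)
    then show ?thesis by (meson inner_gt_zero_iff linorder_not_le)
  qed
  then have "inj h" using linear_injective_0[OF h] by blast
  then have "surj h" using linear_injective_imp_surjective[OF h] by blast
  then obtain y where y: "h y = f u" by (metis surjD)
  have "0 \<le> (u - y) \<bullet> h (u - y)"
    using lower[of "u - y"] m hf by (metis inner_ge_zero mult_nonneg_nonneg order.trans less_imp_le)
  then have 1: "u \<bullet> f u \<le> y \<bullet> h y"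
    using hf[of u] y sym[of u y] by (simp add: hl inner_diff inner_commute)
  define Z where "Z = (\<lambda>x. h x - m *\<^sub>R x)"
  define c where "c = M - m"
  have Z: "linear Z" unfolding Z_def
    by (intro linear_compose_sub h linear_scale_self)
  note Zl = linear_add[OF Z] linear_diff[OF Z] linear_scale[OF Z]
  have Zsym: "Z x \<bullet> y = x \<bullet> Z y" for x y by (simp add: Z_def inner_diff sym)
  have Zpos: "0 \<le> x \<bullet> Z x" for x using lower[of x] hf[of x] by (simp add: Z_def inner_diff)
  have Zle: "x \<bullet> Z x \<le> c * (x \<bullet> x)" for x
    using upper[of x] hf[of x] by (simp add: Z_def c_def inner_diff algebra_simps)
  \<comment> \<open>for \<open>c > 0\<close>, the form of \<open>Z\<close> at \<open>c x - Z x\<close> and that of \<open>c - Z\<close> at \<open>Z x\<close> are nonnegative\<close>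
  have 2: "Z x \<bullet> Z x \<le> c * (x \<bullet> Z x)" for x
  proof (cases "c \<le> 0")
    case True
    have 0: "x \<bullet> Z x = 0" for x
      using Zpos[of x] Zle[of x] True
      by (smt (verit) inner_ge_zero mult_nonpos_nonneg)
    \<comment> \<open>polarization: a symmetric operator whose form vanishes is 0\<close>
    have "(x + Z x) \<bullet> Z (x + Z x) = 0" by (rule 0)
    then have "Z x \<bullet> Z x = 0"
      using 0[of x] 0[of "Z x"] Zsym[of x "Z x"] by (simp add: Zl inner_add inner_commute)
    then show ?thesis using 0 by simp
  next
    case False
    have "0 \<le> (c *\<^sub>R x - Z x) \<bullet> Z (c *\<^sub>R x - Z x)" by (rule Zpos)
    also have "\<dots> = c * (c * (x \<bullet> Z x)) - 2 * c * (Z x \<bullet> Z x) + Z x \<bullet> Z (Z x)"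
      using Zsym[of x "Z x"] by (simp add: Zl inner_diff inner_commute algebra_simps)
    also have "\<dots> \<le> c * (c * (x \<bullet> Z x) - Z x \<bullet> Z x)"
      using Zle[of "Z x"] by (simp add: algebra_simps)
    finally show ?thesis using False by (simp add: zero_le_mult_iff)
  qed
  have 3: "0 \<le> m * (c * (y \<bullet> Z y) - Z y \<bullet> Z y)" using 2[of y] m by simp
  have 4: "0 \<le> c * (Z y \<bullet> Z y) - Z y \<bullet> Z (Z y)" using Zle[of "Z y"] by simp
  have hZ: "h x = Z x + m *\<^sub>R x" for x by (simp add: Z_def)
  have "(m + M) * (h y \<bullet> h y) - h y \<bullet> h (h y) - m * M * (y \<bullet> h y)
      = (c * (Z y \<bullet> Z y) - Z y \<bullet> Z (Z y)) + m * (c * (y \<bullet> Z y) - Z y \<bullet> Z y)"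
    using Zsym[of y "Z y"] Zsym[of y y]
    unfolding hZ by (simp add: Zl inner_add c_def algebra_simps inner_commute)
  with 3 4 have "m * M * (y \<bullet> h y) \<le> (m + M) * (h y \<bullet> h y) - h y \<bullet> h (h y)" by linarith
  moreover have "m * M * (u \<bullet> f u) \<le> m * M * (y \<bullet> h y)"
    using 1 m mM by (intro mult_left_mono) auto
  ultimately show ?thesis using hf[of "f u"] y by simp
qed

text \<open>The chord bound: for a number \<open>m \<le> y \<le> M\<close> it says \<open>m M / y \<le> m + M -
  y\<close>, that is \<open>(y - m) (M - y) \<ge> 0\<close>.\<close>

lemma re_bounded_inverse_upper_bound:
  fixes Y :: "complex^'n^'n"
  assumes inv: "invertible Y" and m: "0 < m" and mM: "m \<le> M"
    and lower: "\<And>x. m * (norm x)\<^sup>2 \<le> Re (quad_form Y x)"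
    and upper: "\<And>x. Re (quad_form Y x) \<le> M * (norm x)\<^sup>2"
  shows "m * M * Re (quad_form (matrix_inv Y) x) \<le> (m + M) * (norm x)\<^sup>2 - Re (quad_form Y x)"
  using linear_kantorovich_bound[OF linear_matrix_vector_mult m mM, of Y "matrix_inv Y *v x"] lower upper
  by (simp add: Re_quad_form power2_norm_eq_inner matrix_mult_inv_vec[OF inv] inner_commute)

section \<open>Comparison of determinants\<close>

text \<open>The determinant is the product of the eigenvalues: \<open>det (X - z)\<close> is a polynomial in
  \<open>z\<close> of degree \<open>n\<close> with leading coefficient \<open>\<plusminus>1\<close>, and its value
  at 0 is, up to sign, the product of its roots.\<close>

lemma norm_det_le_eigenvalue_power:
  fixes X :: "complex^'n^'n"
  assumes eig: "\<And>z x. x \<noteq> 0 \<Longrightarrow> X *v x = z *s x \<Longrightarrow> cmod z \<le> k"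
  shows "cmod (det X) \<le> k ^ CARD('n)"
proof -
  define E where "E = (\<lambda>i j. [:X $ i $ j, if i = j then -1 else 0:])"
  define T where "T = (\<lambda>p. of_int (sign p) * (\<Prod>i\<in>UNIV. E i (p i)))"
  define P where "P = (\<Sum>p\<in>{p. p permutes (UNIV::'n set)}. T p)"
  have evalP: "poly P z = det (X - mat z)" for z
  proof -
    have "poly (E i j) z = (X - mat z) $ i $ j" for i j by (simp add: E_def mat_def)
    then show ?thesis by (simp add: P_def T_def det_def poly_sum poly_prod)
  qed
  have degE: "degree (E i j) \<le> (if i = j then 1 else 0)" for i j by (simp add: E_def)
  have idT: "degree (T id) = CARD('n)" "coeff (T id) CARD('n) = (-1) ^ CARD('n)"
  proof -
    have ne: "E i i \<noteq> 0" and deg: "degree (E i i) = 1" and lc: "lead_coeff (E i i) = -1" for i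
      by (simp_all add: E_def)
    show d: "degree (T id) = CARD('n)"
      using ne deg by (simp add: T_def sign_id degree_prod_sum_eq)
    have "lead_coeff (T id) = (-1) ^ CARD('n)"
      using lc unfolding T_def by (simp add: sign_id lead_coeff_prod del: One_nat_def)
    then show "coeff (T id) CARD('n) = (-1) ^ CARD('n)" by (simp add: d)
  qed
  \<comment> \<open>only the diagonal entries contain the indeterminate, and \<open>p\<close> misses one of them\<close>
  have otherT: "degree (T p) < CARD('n)" if "p permutes UNIV" "p \<noteq> id" for p
  proof -
    obtain i where i: "p i \<noteq> i" using \<open>p \<noteq> id\<close> by (auto simp: fun_eq_iff)
    have "degree (T p) \<le> degree (\<Prod>i\<in>UNIV. E i (p i))"
      unfolding T_def by (rule order_trans[OF degree_mult_le]) simp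
    also have "\<dots> \<le> (\<Sum>i\<in>UNIV. degree (E i (p i)))"
      using degree_prod_sum_le[of UNIV "\<lambda>i. E i (p i)"] by (simp add: o_def)
    also have "\<dots> \<le> (\<Sum>i\<in>UNIV. if i = p i then 1 else 0)" by (intro sum_mono degE)
    also have "\<dots> = card {i. i = p i}" by (simp add: sum.If_cases)
    also have "\<dots> < CARD('n)" using i by (intro psubset_card_mono) (auto simp: psubset_eq set_eq_iff eq_commute)
    finally show ?thesis .
  qed
  have fin: "finite {p. p permutes (UNIV::'n set)}" by (simp add: finite_permutations)
  have Psplit: "P = T id + (\<Sum>p\<in>{p. p permutes (UNIV::'n set)} - {id}. T p)"
    unfolding P_def by (subst sum.remove[OF fin, of id]) (auto simp: permutes_id)
  have rest: "degree (\<Sum>p\<in>{p. p permutes (UNIV::'n set)} - {id}. T p) < CARD('n)"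
    using otherT by (intro degree_sum_less) auto
  have degP: "degree P = CARD('n)"
    unfolding Psplit using rest idT(1) by (subst degree_add_eq_left) auto
  have "lead_coeff P = (-1) ^ CARD('n)"
    using idT(2) coeff_eq_0[OF rest] unfolding degP by (simp add: Psplit)
  then have lead: "cmod (lead_coeff P) = 1" by (simp add: norm_power)
  obtain root where root: "smult (lead_coeff P) (\<Prod>i<degree P. [:-root i, 1:]) = P"
    by (rule complex_poly_decompose'[of P])
  have evalP': "poly P z = lead_coeff P * (\<Prod>i<degree P. z - root i)" for z
    by (subst root[symmetric]) (simp add: poly_prod del: mult_cancel_left)
  have bound: "cmod (root i) \<le> k" if "i < degree P" for i
  proof -
    have "det (X - mat (root i)) = 0"
      using that unfolding evalP[symmetric] evalP' by (auto intro: prod_zero)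
    then have "\<not> invertible (X - mat (root i))" by (simp add: invertible_det_nz)
    then obtain x where "x \<noteq> 0" and x: "(X - mat (root i)) *v x = 0"
      by (auto simp: invertible_left_inverse matrix_left_invertible_ker)
    have "X *v x = root i *s x"
      using x by (simp add: matrix_vector_mult_diff_rdistrib mat_mult_vec)
    then show ?thesis by (rule eig[OF \<open>x \<noteq> 0\<close>])
  qed
  have "det X = poly P 0" by (simp add: evalP mat_0)
  also have "\<dots> = lead_coeff P * (\<Prod>i<degree P. - root i)" by (simp add: evalP')
  finally have "cmod (det X) = (\<Prod>i<degree P. cmod (root i))"
    by (simp add: norm_mult lead prod_norm[symmetric])
  also have "\<dots> \<le> (\<Prod>i<degree P. k)" using bound by (intro prod_mono) auto
  finally show ?thesis by (simp add: degP)
qed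

text \<open>An eigenvector of \<open>D\<^sup>-\<^sup>1G\<close> for \<open>z\<close> satisfies \<open>Gx = z
  Dx\<close>, hence \<open>x\<^sup>*Gx = z x\<^sup>*Dx\<close>, and the comparison of forms bounds
  \<open>\<bar>z\<bar>\<close>.\<close>

lemma cmod_det_le_of_quad_form_le:
  fixes G D :: "complex^'n^'n"
  assumes nz: "\<And>x. x \<noteq> 0 \<Longrightarrow> quad_form D x \<noteq> 0"
    and le: "\<And>x. cmod (quad_form G x) \<le> k * cmod (quad_form D x)"
  shows "cmod (det G) \<le> k ^ CARD('n) * cmod (det D)"
proof -
  have "x = 0" if "D *v x = 0" for x
    using nz[of x] that by (auto simp: quad_form_def cinner_vec_def)
  then have inv: "invertible D"
    by (simp add: invertible_left_inverse matrix_left_invertible_ker)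
  define X where "X = matrix_inv D ** G"
  have G: "G = D ** X"
    by (simp add: matrix_eq X_def matrix_vector_mul_assoc[symmetric] matrix_mult_inv_vec[OF inv])
  have "cmod (det X) \<le> k ^ CARD('n)"
  proof (rule norm_det_le_eigenvalue_power)
    fix z x assume x: "x \<noteq> 0" "X *v x = z *s x"
    have "G *v x = z *s (D *v x)"
      by (simp add: G x(2) vec.scale matrix_vector_mul_assoc[symmetric])
    then have "quad_form G x = z * quad_form D x"
      by (simp add: quad_form_def cinner_vec_scale_right)
    then have "cmod z * cmod (quad_form D x) \<le> k * cmod (quad_form D x)"
      using le[of x] by (simp add: norm_mult)
    then show "cmod z \<le> k" using nz[OF x(1)] by (simp add: mult_le_cancel_right)
  qed
  then have "cmod (det D) * cmod (det X) \<le> cmod (det D) * k ^ CARD('n)"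
    by (intro mult_left_mono) auto
  then show ?thesis by (simp add: G det_mul norm_mult mult.commute)
qed

section \<open>The weight of the geometric mean\<close>

text \<open>The Beta integral on the half-line, from the one on \<open>[0, 1]\<close> by the substitution \<open>s
  = t / (1 - t)\<close>.\<close>

lemma has_integral_beta_halfline:
  fixes a b :: real
  assumes "0 < a" "0 < b"
  shows "((\<lambda>s. s powr (a - 1) * (1 + s) powr (- (a + b))) has_integral Beta a b) {0<..}"
proof -
  let ?f = "\<lambda>s::real. s powr (a - 1) * (1 + s) powr (- (a + b))"
  let ?g = "\<lambda>t::real. t / (1 - t)"
  let ?g' = "\<lambda>t::real. 1 / (1 - t)\<^sup>2"
  let ?b = "\<lambda>t. t powr (a - 1) * (1 - t) powr (b - 1)"
  have b: "(?b has_integral Beta a b) {0<..<1}"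
    using has_integral_Beta_real[OF assms] by (simp add: has_integral_Icc_iff_Ioo)
  have eq: "\<bar>?g' t\<bar> * ?f (?g t) = ?b t" if "t \<in> {0<..<1}" for t
  proof -
    have t: "0 < t" "0 < 1 - t" using that by auto
    have "1 + ?g t = 1 / (1 - t)" using t by (simp add: field_simps)
    moreover have inv_powr: "(1 / (1 - t)) powr e = (1 - t) powr (- e)" for e
      using t by (simp add: powr_divide powr_minus_divide)
    ultimately have "(1 + ?g t) powr (- (a + b)) = (1 - t) powr (a + b)"
      using inv_powr[of "- (a + b)"] by (simp add: add.commute)
    moreover have "?g t powr (a - 1) = t powr (a - 1) * (1 - t) powr (- (a - 1))"
      using t powr_mult[of t "1 / (1 - t)" "a - 1"] by (simp only: inv_powr) simp
    moreover have "\<bar>?g' t\<bar> = (1 - t) powr (-2)"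
      using t by (simp add: powr_minus_divide powr_numeral)
    ultimately have "\<bar>?g' t\<bar> * ?f (?g t) = (1 - t) powr (-2) * ((t powr (a - 1) * (1 - t) powr (- (a - 1))) * (1 - t) powr (a + b))"
      by simp
    also have "\<dots> = t powr (a - 1) * (1 - t) powr (-2 + - (a - 1) + (a + b))"
      by (simp only: powr_add mult_ac)
    also have "-2 + - (a - 1) + (a + b) = b - 1" by simp
    finally show ?thesis .
  qed
  have int: "((\<lambda>t. \<bar>?g' t\<bar> * ?f (?g t)) has_integral Beta a b) {0<..<1}"
    using eq[symmetric] b by (rule has_integral_eq)
  then have "(\<lambda>t. \<bar>?g' t\<bar> * ?f (?g t)) absolutely_integrable_on {0<..<1} \<and>
      integral {0<..<1} (\<lambda>t. \<bar>?g' t\<bar> * ?f (?g t)) = Beta a b"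
    by (auto intro!: nonnegative_absolutely_integrable_1 integral_unique simp: has_integral_integrable)
  moreover have "(?g has_field_derivative ?g' t) (at t within {0<..<1})" if "t \<in> {0<..<1}" for t
    using that by (auto intro!: derivative_eq_intros simp: field_simps power2_eq_square)
  moreover have "inj_on ?g {0<..<1}"
    by (auto simp: inj_on_def field_simps)
  ultimately have "?f absolutely_integrable_on (?g ` {0<..<1}) \<and> integral (?g ` {0<..<1}) ?f = Beta a b"
    using has_absolute_integral_change_of_variables_1'[of "{0<..<1}" ?g ?g' ?f "Beta a b"] by simp
  moreover have "?g ` {0<..<1} = {0<..}"
  proof (intro equalityI subsetI)
    fix s :: real assume "s \<in> {0<..}"
    then have "s = ?g (s / (1 + s))" "s / (1 + s) \<in> {0<..<1}" by (auto simp: field_simps)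
    then show "s \<in> ?g ` {0<..<1}" by blast
  qed auto
  ultimately show ?thesis
    by (auto simp: has_integral_iff dest: set_lebesgue_integral_eq_integral(1))
qed

definition geom_weight :: "real \<Rightarrow> real \<Rightarrow> real" where
  "geom_weight v s = sin (v * pi) / pi * s powr (v - 1)"

lemma Gamma_reflection_real:
  fixes v :: real
  assumes "0 < v" "v < 1"
  shows "Gamma v * Gamma (1 - v) = pi / sin (v * pi)"
proof -
  have "complex_of_real (Gamma v * Gamma (1 - v)) = Gamma (of_real v) * Gamma (1 - of_real v)"
    by (simp add: Gamma_complex_of_real[symmetric])
  also have "\<dots> = of_real (pi / sin (v * pi))"
    by (simp add: Gamma_reflection_complex sin_of_real[symmetric] mult.commute)
  finally show ?thesis by (simp only: of_real_eq_iff)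
qed

text \<open>The first two integrals say that \<open>geom_weight v s / (1 + s)\<close> is a probability density
  under which \<open>s / (1 + s)\<close> has mean \<open>v\<close>. They are Beta integrals, evaluated by the
  reflection formula.\<close>

lemma geom_weight_integrals:
  assumes "0 < v" "v < 1"
  shows "((\<lambda>s. geom_weight v s / (1 + s)) has_integral 1) {0<..}"
    and "((\<lambda>s. geom_weight v s * s / (1 + s)\<^sup>2) has_integral v) {0<..}"
    and "((\<lambda>s. geom_weight v s / (1 + s)\<^sup>2) has_integral (1 - v)) {0<..}"
proof -
  have sin: "sin (v * pi) > 0" using assms by (intro sin_gt_zero) auto
  have G: "Gamma v * Gamma (1 - v) = pi / sin (v * pi)" by (rule Gamma_reflection_real[OF assms])
  have "Gamma (v + 1) = v * Gamma v" using assms by (intro Gamma_plus1) (auto elim!: nonpos_Ints_cases')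
  moreover have "Gamma (2::real) = 1" using Gamma_fact[of 1, where 'a = real] by simp
  ultimately have B: "sin (v * pi) / pi * Beta v (1 - v) = 1" "sin (v * pi) / pi * Beta (v + 1) (1 - v) = v"
    using G sin by (simp_all add: Beta_def mult.assoc)
  have "((\<lambda>s. sin (v * pi) / pi * (s powr (v - 1) * (1 + s) powr (- (v + (1 - v))))) has_integral 1) {0<..}"
    using has_integral_mult_right[OF has_integral_beta_halfline[of v "1 - v"], of "sin (v * pi) / pi"] assms B by simp
  then show 1: "((\<lambda>s. geom_weight v s / (1 + s)) has_integral 1) {0<..}"
    by (rule has_integral_eq[rotated]) (auto simp: geom_weight_def powr_minus field_simps)
  have "((\<lambda>s. sin (v * pi) / pi * (s powr (v + 1 - 1) * (1 + s) powr (- (v + 1 + (1 - v))))) has_integral v) {0<..}"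
    using has_integral_mult_right[OF has_integral_beta_halfline[of "v + 1" "1 - v"], of "sin (v * pi) / pi"] assms B by simp
  then show 2: "((\<lambda>s. geom_weight v s * s / (1 + s)\<^sup>2) has_integral v) {0<..}"
    by (rule has_integral_eq[rotated])
      (auto simp: geom_weight_def powr_minus powr_diff powr_numeral field_simps)
  have "geom_weight v s / (1 + s) - geom_weight v s * s / (1 + s)\<^sup>2 = geom_weight v s / (1 + s)\<^sup>2"
    if "s \<in> {0<..}" for s
  proof -
    have "geom_weight v s / (1 + s) = geom_weight v s * (1 + s) / (1 + s)\<^sup>2"
      using that by (simp add: power2_eq_square)
    then show ?thesis by (simp add: diff_divide_distrib[symmetric] algebra_simps)
  qed
  then show "((\<lambda>s. geom_weight v s / (1 + s)\<^sup>2) has_integral (1 - v)) {0<..}"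
    using has_integral_diff[OF 1 2] by (rule has_integral_eq)
qed

lemma geom_weight_nonneg: "0 \<le> v \<Longrightarrow> v \<le> 1 \<Longrightarrow> 0 \<le> geom_weight v s"
  by (auto simp: geom_weight_def intro!: mult_nonneg_nonneg sin_ge_zero divide_nonneg_pos mult_left_le_one_le)

text \<open>For \<open>y s = (p + s q) / (1 + s)\<close> the integrand is \<open>a - y s\<close> times the
  probability density. Integration replaces \<open>y s\<close> by its mean \<open>(1 - v) p + v q\<close>, which is
  the integration step of Jensen's inequality.\<close>

lemma geom_weight_jensen_integral:
  assumes "0 < v" "v < 1"
  shows "((\<lambda>s. geom_weight v s * (a / (1 + s) - (p + s * q) / (1 + s)\<^sup>2)) has_integral
    (a - ((1 - v) * p + v * q))) {0<..}"
proof -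
  note I = geom_weight_integrals[OF assms]
  have "((\<lambda>s. a * (geom_weight v s / (1 + s)) - (p * (geom_weight v s / (1 + s)\<^sup>2)
      + q * (geom_weight v s * s / (1 + s)\<^sup>2))) has_integral (a * 1 - (p * (1 - v) + q * v))) {0<..}"
    by (intro has_integral_diff has_integral_add has_integral_mult_right I)
  then show ?thesis
    by (simp add: algebra_simps add_divide_distrib)
qed

section \<open>The geometric mean as an average of inverses\<close>

text \<open>Cramer's rule for the columns of the inverse; it reduces the continuity of inversion to that of
  determinants.\<close>

lemma matrix_inv_entry:
  fixes A :: "complex^'n^'n"
  assumes "invertible A"
  shows "matrix_inv A $ k $ j
    = det (\<chi> i l. if l = k then axis j 1 $ i else A $ i $ l) / det A"
proof -
  have "det A \<noteq> 0" using assms by (simp add: invertible_det_nz)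
  then have "matrix_inv A *v axis j 1
      = (\<chi> k. det (\<chi> i l. if l = k then axis j 1 $ i else A $ i $ l) / det A)"
    using cramer[of A "matrix_inv A *v axis j 1" "axis j 1"] by (simp add: matrix_mult_inv_vec[OF assms])
  then have "(matrix_inv A *v axis j 1) $ k
      = det (\<chi> i l. if l = k then axis j 1 $ i else A $ i $ l) / det A"
    by simp
  then show ?thesis by (simp only: matrix_mult_axis)
qed

lemma continuous_on_det:
  fixes f :: "'a::topological_space \<Rightarrow> complex^'n^'n"
  assumes "\<And>i j. continuous_on S (\<lambda>s. f s $ i $ j)"
  shows "continuous_on S (\<lambda>s. det (f s))"
  unfolding det_def by (intro continuous_intros assms)

lemma continuous_on_matrix_inv:
  fixes f :: "'a::topological_space \<Rightarrow> complex^'n^'n"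
  assumes f: "continuous_on S f" and inv: "\<And>s. s \<in> S \<Longrightarrow> invertible (f s)"
  shows "continuous_on S (\<lambda>s. matrix_inv (f s))"
proof -
  have f': "continuous_on S (\<lambda>s. f s $ i $ j)" for i j by (intro continuous_intros f)
  have "continuous_on S (\<lambda>s. (\<chi> i l. if l = k then axis j 1 $ i else f s $ i $ l) $ i $ l)" for k j i l
    by (cases "l = k") (simp_all add: f')
  then have num: "continuous_on S (\<lambda>s. det (\<chi> i l. if l = k then axis j 1 $ i else f s $ i $ l))" for k j
    by (rule continuous_on_det)
  have "continuous_on S (\<lambda>s. \<chi> k j. det (\<chi> i l. if l = k then axis j 1 $ i else f s $ i $ l) / det (f s))"
    using inv invertible_det_nz
    by (intro continuous_on_vec_lambda continuous_on_divide num continuous_on_det f') auto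
  then show ?thesis
    by (rule continuous_on_eq) (simp add: vec_eq_iff matrix_inv_entry inv)
qed

lemma norm_matrix_le:
  fixes A :: "complex^'n^'n"
  assumes "\<And>x. norm (A *v x) \<le> K * norm x"
  shows "norm A \<le> (real CARD('n))\<^sup>2 * K"
proof -
  have entry: "cmod (A $ i $ j) \<le> K" for i j
  proof -
    have "A $ i $ j = (A *v axis j 1) $ i" by (simp add: matrix_mult_axis)
    then have "cmod (A $ i $ j) \<le> norm (A *v axis j 1)" by (simp only: Finite_Cartesian_Product.norm_nth_le)
    also have "\<dots> \<le> K" using assms[of "axis j 1"] by simp
    finally show ?thesis .
  qed
  have "norm A \<le> (\<Sum>i\<in>UNIV. norm (A $ i))"
    unfolding norm_vec_def[of A] by (rule L2_set_le_sum) simp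
  also have "\<dots> \<le> (\<Sum>i\<in>UNIV. \<Sum>j\<in>UNIV. cmod (A $ i $ j))"
    by (intro sum_mono) (simp add: norm_vec_def L2_set_le_sum)
  also have "\<dots> \<le> (\<Sum>i\<in>(UNIV :: 'n set). \<Sum>j\<in>(UNIV :: 'n set). K)" by (intro sum_mono entry)
  finally show ?thesis by (simp add: power2_eq_square)
qed

text \<open>The real part of the form is continuous and positive on the compact unit sphere; homogeneity extends
  its minimum there to a bound on all vectors.\<close>

lemma sectorial_coercive:
  fixes A :: "complex^'n^'n"
  assumes "sectorial t A"
  obtains c where "0 < c" "\<And>x. c * (norm x)\<^sup>2 \<le> Re (quad_form A x)"
proof -
  let ?S = "sphere (0 :: complex^'n) 1"
  have "continuous_on ?S (\<lambda>x. x \<bullet> (A *v x))"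
    by (intro continuous_intros linear_continuous_on linear_linear[THEN iffD1] linear_matrix_vector_mult)
  moreover have "axis undefined 1 \<in> ?S" by simp
  then have "?S \<noteq> {}" by blast
  ultimately obtain y where y: "y \<in> ?S" "\<And>x. x \<in> ?S \<Longrightarrow> y \<bullet> (A *v y) \<le> x \<bullet> (A *v x)"
    using continuous_attains_inf[OF compact_sphere] by blast
  show thesis
  proof
    have "y \<noteq> 0" using y(1) by auto
    then show "0 < y \<bullet> (A *v y)" using assms by (auto simp: sectorial_def Re_quad_form)
    show "(y \<bullet> (A *v y)) * (norm x)\<^sup>2 \<le> Re (quad_form A x)" for x
    proof (cases "x = 0")
      case False
      then have "y \<bullet> (A *v y) \<le> (inverse (norm x) *\<^sub>R x) \<bullet> (A *v (inverse (norm x) *\<^sub>R x))"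
        by (intro y(2)) simp
      then show ?thesis
        using False by (simp add: linear_scale[OF linear_matrix_vector_mult] Re_quad_form field_simps power2_eq_square)
    qed (simp add: Re_quad_form)
  qed
qed

text \<open>Coercivity of \<open>P\<close> and \<open>Q\<close> bounds the norm of \<open>(P + s
  Q)\<^sup>-\<^sup>1\<close> by a multiple of \<open>1 / (1 + s)\<close>, so the integrand is continuous and
  dominated by a multiple of the first integrand of \<open>geom_weight_integrals\<close>.\<close>

lemma geom_mean_integrand_integrable:
  fixes P Q :: "complex^'n^'n"
  assumes P: "sectorial t P" and Q: "sectorial t Q" and v: "0 < v" "v < 1"
  shows "(\<lambda>s. (s powr (v - 1)) *\<^sub>R matrix_inv (P + s *\<^sub>R Q)) integrable_on {0<..}"
proof -
  obtain p q where pq: "0 < p" "\<And>x. p * (norm x)\<^sup>2 \<le> Re (quad_form P x)"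
    "0 < q" "\<And>x. q * (norm x)\<^sup>2 \<le> Re (quad_form Q x)"
    using sectorial_coercive[OF P] sectorial_coercive[OF Q] by metis
  define c where "c = min p q"
  have c: "0 < c" "c \<le> p" "c \<le> q" using pq by (auto simp: c_def)
  have sect: "sectorial t (P + s *\<^sub>R Q)" if "0 < s" for s
    using that by (intro sectorial_add sectorial_scaleR P Q)
  have bound: "norm (matrix_inv (P + s *\<^sub>R Q)) \<le> (real CARD('n))\<^sup>2 * (1 / (c * (1 + s)))" if s: "0 < s" for s
  proof (rule norm_matrix_le)
    fix x
    have inv: "invertible (P + s *\<^sub>R Q)" using sect[OF s] by (rule sectorial_invertible)
    define u where "u = matrix_inv (P + s *\<^sub>R Q) *v x"
    have x: "(P + s *\<^sub>R Q) *v u = x" by (simp add: u_def matrix_mult_inv_vec[OF inv])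
    have "c * (norm u)\<^sup>2 \<le> Re (quad_form P u)" "c * (norm u)\<^sup>2 \<le> Re (quad_form Q u)"
      using pq(2)[of u] pq(4)[of u] mult_right_mono[OF c(2), of "(norm u)\<^sup>2"]
        mult_right_mono[OF c(3), of "(norm u)\<^sup>2"] by simp_all
    then have "c * (norm u)\<^sup>2 + s * (c * (norm u)\<^sup>2) \<le> Re (quad_form P u) + s * Re (quad_form Q u)"
      using s by (intro add_mono mult_left_mono) auto
    also have "\<dots> = u \<bullet> x"
      using x by (simp add: Re_quad_form[symmetric] quad_form_add quad_form_scaleR flip: x)
    also have "\<dots> \<le> norm u * norm x" by (rule norm_cauchy_schwarz)
    finally have "norm u * (c * (1 + s) * norm u) \<le> norm u * norm x"
      by (simp add: algebra_simps power2_eq_square)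
    then have "c * (1 + s) * norm u \<le> norm x"
      by (cases "u = 0") (auto simp: mult_le_cancel_left)
    then show "norm (matrix_inv (P + s *\<^sub>R Q) *v x) \<le> 1 / (c * (1 + s)) * norm x"
      using c s by (simp add: u_def[symmetric] pos_le_divide_eq mult.commute)
  qed
  have sin: "0 < sin (v * pi)" using v by (intro sin_gt_zero) auto
  have meas: "{0<..} \<in> sets (lebesgue :: real measure)" by simp
  have "continuous_on {0<..} (\<lambda>s. (s powr (v - 1)) *\<^sub>R matrix_inv (P + s *\<^sub>R Q))"
    using sect sectorial_invertible
    by (intro continuous_intros continuous_on_matrix_inv) auto
  then have "(\<lambda>s. (s powr (v - 1)) *\<^sub>R matrix_inv (P + s *\<^sub>R Q)) \<in> borel_measurable (lebesgue_on {0<..})"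
    using meas by (rule continuous_imp_measurable_on_sets_lebesgue)
  moreover have "(\<lambda>s. (pi / sin (v * pi) * (real CARD('n))\<^sup>2 / c) * (geom_weight v s / (1 + s))) integrable_on {0<..}"
    using geom_weight_integrals(1)[OF v] by (intro has_integral_integrable[OF has_integral_mult_right])
  moreover have "norm ((s powr (v - 1)) *\<^sub>R matrix_inv (P + s *\<^sub>R Q))
      \<le> (pi / sin (v * pi) * (real CARD('n))\<^sup>2 / c) * (geom_weight v s / (1 + s))" if "s \<in> {0<..}" for s
  proof -
    have "norm ((s powr (v - 1)) *\<^sub>R matrix_inv (P + s *\<^sub>R Q))
        \<le> s powr (v - 1) * ((real CARD('n))\<^sup>2 * (1 / (c * (1 + s))))"
      using that mult_left_mono[OF bound[of s], of "s powr (v - 1)"] by simp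
    then show ?thesis using sin by (simp add: geom_weight_def mult_ac)
  qed
  ultimately show ?thesis
    using meas by (rule measurable_bounded_by_integrable_imp_integrable)
qed

text \<open>Taking the quadratic form at a fixed vector is a bounded linear functional of the matrix, so it
  commutes with the integral. From here on only scalar integrals occur.\<close>

lemma quad_form_geom_mean_has_integral:
  fixes A B :: "complex^'n^'n"
  assumes "sectorial t A" "sectorial t B" "0 < v" "v < 1"
  shows "((\<lambda>s. geom_weight v s *\<^sub>R quad_form (matrix_inv (matrix_inv A + s *\<^sub>R matrix_inv B)) x)
    has_integral quad_form (geom_mean v A B) x) {0<..}"
proof -
  let ?F = "\<lambda>s. (s powr (v - 1)) *\<^sub>R matrix_inv (matrix_inv A + s *\<^sub>R matrix_inv B)"
  have "?F integrable_on {0<..}"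
    using assms by (intro geom_mean_integrand_integrable[of t] sectorial_matrix_inv)
  then have "(?F has_integral integral {0<..} ?F) {0<..}" by (rule integrable_integral)
  from has_integral_cmul[OF this, of "sin (v * pi) / pi"]
  have "((\<lambda>s. (sin (v * pi) / pi) *\<^sub>R ?F s) has_integral geom_mean v A B) {0<..}"
    using assms by (simp add: geom_mean_def)
  from has_integral_linear[OF this bounded_linear_quad_form[of x]] show ?thesis
    by (simp add: o_def quad_form_scaleR geom_weight_def)
qed

text \<open>The tangent bound is applied to \<open>P + s Q\<close> with parameter \<open>\<tau> / (1 + s)\<close>,
  which amounts to \<open>\<tau>\<close> for the normalised matrix \<open>(P + s Q) / (1 + s)\<close>. The
  endpoints \<open>v = 0\<close> and \<open>v = 1\<close>, where the mean is not given by the integral, are the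
  tangent bounds for \<open>A\<^sup>-\<^sup>1\<close> and \<open>B\<^sup>-\<^sup>1\<close> themselves.\<close>

lemma geom_mean_lower_bound:
  fixes A B :: "complex^'n^'n"
  assumes A: "sectorial t A" and B: "sectorial t B" and t: "0 \<le> t" and v: "0 \<le> v" "v \<le> 1"
  shows "2 * \<tau> * (norm x)\<^sup>2
      - \<tau>\<^sup>2 * ((1 - v) * Re (quad_form (matrix_inv A) x) + v * Re (quad_form (matrix_inv B) x))
    \<le> (1 + t\<^sup>2) * Re (quad_form (geom_mean v A B) x)"
proof -
  consider "v = 0" | "v = 1" | "0 < v" "v < 1" using v by linarith
  then show ?thesis
  proof cases
    case 1
    then show ?thesis
      using sectorial_inverse_lower_bound[OF sectorial_matrix_inv[OF A] t, of \<tau> x]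
      by (simp add: geom_mean_def matrix_inv_matrix_inv[OF A])
  next
    case 2
    then show ?thesis
      using sectorial_inverse_lower_bound[OF sectorial_matrix_inv[OF B] t, of \<tau> x]
      by (simp add: geom_mean_def matrix_inv_matrix_inv[OF B])
  next
    case 3
    let ?P = "matrix_inv A" and ?Q = "matrix_inv B"
    have "2 * \<tau> * (norm x)\<^sup>2 - ((1 - v) * (\<tau>\<^sup>2 * Re (quad_form ?P x)) + v * (\<tau>\<^sup>2 * Re (quad_form ?Q x)))
        \<le> (1 + t\<^sup>2) * Re (quad_form (geom_mean v A B) x)"
    proof (rule has_integral_le)
      show "((\<lambda>s. geom_weight v s * (2 * \<tau> * (norm x)\<^sup>2 / (1 + s)
            - (\<tau>\<^sup>2 * Re (quad_form ?P x) + s * (\<tau>\<^sup>2 * Re (quad_form ?Q x))) / (1 + s)\<^sup>2)) has_integral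
          (2 * \<tau> * (norm x)\<^sup>2 - ((1 - v) * (\<tau>\<^sup>2 * Re (quad_form ?P x)) + v * (\<tau>\<^sup>2 * Re (quad_form ?Q x))))) {0<..}"
        using 3 by (rule geom_weight_jensen_integral)
      show "((\<lambda>s. (1 + t\<^sup>2) * (geom_weight v s * Re (quad_form (matrix_inv (?P + s *\<^sub>R ?Q)) x))) has_integral
          (1 + t\<^sup>2) * Re (quad_form (geom_mean v A B) x)) {0<..}"
        using has_integral_mult_right[OF has_integral_linear[OF quad_form_geom_mean_has_integral[OF A B 3, of x] bounded_linear_Re], of "1 + t\<^sup>2"]
        by (simp add: o_def)
      fix s :: real assume "s \<in> {0<..}"
      then have s: "0 < s" by simp
      have "sectorial t (?P + s *\<^sub>R ?Q)"
        using s by (intro sectorial_add sectorial_scaleR sectorial_matrix_inv A B)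
      from sectorial_inverse_lower_bound[OF this t, of "\<tau> / (1 + s)" x]
      have "2 * \<tau> * (norm x)\<^sup>2 / (1 + s)
            - (\<tau>\<^sup>2 * Re (quad_form ?P x) + s * (\<tau>\<^sup>2 * Re (quad_form ?Q x))) / (1 + s)\<^sup>2
          \<le> (1 + t\<^sup>2) * Re (quad_form (matrix_inv (?P + s *\<^sub>R ?Q)) x)"
        by (simp add: quad_form_add quad_form_scaleR power_divide algebra_simps)
      from mult_left_mono[OF this geom_weight_nonneg[OF v, of s]]
      show "geom_weight v s * (2 * \<tau> * (norm x)\<^sup>2 / (1 + s)
            - (\<tau>\<^sup>2 * Re (quad_form ?P x) + s * (\<tau>\<^sup>2 * Re (quad_form ?Q x))) / (1 + s)\<^sup>2)
          \<le> (1 + t\<^sup>2) * (geom_weight v s * Re (quad_form (matrix_inv (?P + s *\<^sub>R ?Q)) x))"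
        by (simp only: mult.left_commute)
    qed
    then show ?thesis by (simp add: algebra_simps)
  qed
qed

text \<open>The chord bound for \<open>P + s Q\<close>, whose real part lies between \<open>m (1 + s)\<close> and
  \<open>M (1 + s)\<close>, integrated against the weight.\<close>

lemma geom_mean_upper_bound:
  fixes A B :: "complex^'n^'n"
  assumes A: "sectorial t A" and B: "sectorial t B" and v: "0 \<le> v" "v \<le> 1"
    and m: "0 < m" "m \<le> M"
    and PA: "\<And>x. m * (norm x)\<^sup>2 \<le> Re (quad_form (matrix_inv A) x)"
      "\<And>x. Re (quad_form (matrix_inv A) x) \<le> M * (norm x)\<^sup>2"
    and PB: "\<And>x. m * (norm x)\<^sup>2 \<le> Re (quad_form (matrix_inv B) x)"
      "\<And>x. Re (quad_form (matrix_inv B) x) \<le> M * (norm x)\<^sup>2"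
  shows "m * M * Re (quad_form (geom_mean v A B) x)
    \<le> (m + M) * (norm x)\<^sup>2 - ((1 - v) * Re (quad_form (matrix_inv A) x) + v * Re (quad_form (matrix_inv B) x))"
proof -
  note inv = sectorial_invertible[OF sectorial_matrix_inv[OF A]] sectorial_invertible[OF sectorial_matrix_inv[OF B]]
  consider "v = 0" | "v = 1" | "0 < v" "v < 1" using v by linarith
  then show ?thesis
  proof cases
    case 1
    then show ?thesis
      using re_bounded_inverse_upper_bound[OF inv(1) m PA, of x]
      by (simp add: geom_mean_def matrix_inv_matrix_inv[OF A])
  next
    case 2
    then show ?thesis
      using re_bounded_inverse_upper_bound[OF inv(2) m PB, of x]
      by (simp add: geom_mean_def matrix_inv_matrix_inv[OF B])
  next
    case 3
    let ?P = "matrix_inv A" and ?Q = "matrix_inv B"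
    show ?thesis
    proof (rule has_integral_le)
      show "((\<lambda>s. geom_weight v s * ((m + M) * (norm x)\<^sup>2 / (1 + s)
            - (Re (quad_form ?P x) + s * Re (quad_form ?Q x)) / (1 + s)\<^sup>2)) has_integral
          ((m + M) * (norm x)\<^sup>2 - ((1 - v) * Re (quad_form ?P x) + v * Re (quad_form ?Q x)))) {0<..}"
        using 3 by (rule geom_weight_jensen_integral)
      show "((\<lambda>s. m * M * (geom_weight v s * Re (quad_form (matrix_inv (?P + s *\<^sub>R ?Q)) x))) has_integral
          m * M * Re (quad_form (geom_mean v A B) x)) {0<..}"
        using has_integral_mult_right[OF has_integral_linear[OF quad_form_geom_mean_has_integral[OF A B 3, of x] bounded_linear_Re], of "m * M"]
        by (simp add: o_def)
      fix s :: real assume "s \<in> {0<..}"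
      then have s: "0 < s" by simp
      let ?Y = "?P + s *\<^sub>R ?Q"
      have "sectorial t ?Y"
        using s by (intro sectorial_add sectorial_scaleR sectorial_matrix_inv A B)
      then have "invertible ?Y" by (rule sectorial_invertible)
      moreover have "m * (1 + s) * (norm x)\<^sup>2 \<le> Re (quad_form ?Y x)" for x
        using add_mono[OF PA(1)[of x] mult_left_mono[OF PB(1)[of x], of s]] s
        by (simp add: quad_form_add quad_form_scaleR algebra_simps)
      moreover have "Re (quad_form ?Y x) \<le> M * (1 + s) * (norm x)\<^sup>2" for x
        using add_mono[OF PA(2)[of x] mult_left_mono[OF PB(2)[of x], of s]] s
        by (simp add: quad_form_add quad_form_scaleR algebra_simps)
      ultimately have "m * (1 + s) * (M * (1 + s)) * Re (quad_form (matrix_inv ?Y) x)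
          \<le> (m * (1 + s) + M * (1 + s)) * (norm x)\<^sup>2 - Re (quad_form ?Y x)"
        using m s by (intro re_bounded_inverse_upper_bound) auto
      also have "\<dots> = (1 + s)\<^sup>2 * ((m + M) * (norm x)\<^sup>2 / (1 + s)
            - (Re (quad_form ?P x) + s * Re (quad_form ?Q x)) / (1 + s)\<^sup>2)"
        using s by (simp add: quad_form_add quad_form_scaleR right_diff_distrib power2_eq_square) (simp add: algebra_simps)
      finally have "(1 + s)\<^sup>2 * (m * M * Re (quad_form (matrix_inv ?Y) x))
          \<le> (1 + s)\<^sup>2 * ((m + M) * (norm x)\<^sup>2 / (1 + s)
            - (Re (quad_form ?P x) + s * Re (quad_form ?Q x)) / (1 + s)\<^sup>2)"
        by (simp add: power2_eq_square mult_ac)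
      then have "m * M * Re (quad_form (matrix_inv ?Y) x)
          \<le> (m + M) * (norm x)\<^sup>2 / (1 + s)
            - (Re (quad_form ?P x) + s * Re (quad_form ?Q x)) / (1 + s)\<^sup>2"
        using s by (subst (asm) mult_le_cancel_left_pos) auto
      from mult_left_mono[OF this geom_weight_nonneg[OF v, of s]]
      show "m * M * (geom_weight v s * Re (quad_form (matrix_inv (?P + s *\<^sub>R ?Q)) x))
          \<le> geom_weight v s * ((m + M) * (norm x)\<^sup>2 / (1 + s)
            - (Re (quad_form ?P x) + s * Re (quad_form ?Q x)) / (1 + s)\<^sup>2)"
        by (simp only: mult.left_commute)
    qed
  qed
qed

text \<open>The sector is a convex cone, so it is preserved by integration against a nonnegative weight; strict
  positivity of the real part comes from the tangent bound.\<close>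

lemma sectorial_geom_mean:
  fixes A B :: "complex^'n^'n"
  assumes A: "sectorial t A" and B: "sectorial t B" and t: "0 \<le> t" and v: "0 \<le> v" "v \<le> 1"
  shows "sectorial t (geom_mean v A B)"
proof -
  consider "v = 0 \<or> v = 1" | "0 < v" "v < 1" using v by linarith
  then show ?thesis
  proof cases
    case 1
    then show ?thesis using A B by (auto simp: geom_mean_def)
  next
    case 2
    let ?P = "matrix_inv A" and ?Q = "matrix_inv B"
    show ?thesis
      unfolding sectorial_def
    proof (intro allI impI conjI)
      fix x :: "complex^'n" assume "x \<noteq> 0"
      define n where "n = (norm x)\<^sup>2"
      define e where "e = (1 - v) * Re (quad_form ?P x) + v * Re (quad_form ?Q x)"
      \<comment> \<open>small enough for the left-hand side \<open>\<tau> (2n - \<tau>e)\<close> of the tangent bound to be positive\<close>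
      define \<tau> where "\<tau> = n / (1 + e)"
      have n: "0 < n" using \<open>x \<noteq> 0\<close> by (simp add: n_def)
      have e: "0 \<le> e"
        using v sectorial_nonneg(1)[OF sectorial_matrix_inv[OF A]] sectorial_nonneg(1)[OF sectorial_matrix_inv[OF B]]
        by (simp add: e_def)
      have \<tau>: "0 < \<tau>" "\<tau> * e \<le> n"
        using n e by (auto simp: \<tau>_def field_simps)
      have "0 < \<tau> * (2 * n - \<tau> * e)" using n \<tau> by simp
      also have "\<dots> \<le> (1 + t\<^sup>2) * Re (quad_form (geom_mean v A B) x)"
        using geom_mean_lower_bound[OF A B t v, of \<tau> x]
        by (simp add: n_def e_def power2_eq_square algebra_simps)
      finally show "0 < Re (quad_form (geom_mean v A B) x)"
        by (rule zero_less_mult_pos) (simp add: add_pos_nonneg)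
      note I = quad_form_geom_mean_has_integral[OF A B 2, of x]
      note I_Re = has_integral_mult_right[OF has_integral_linear[OF I bounded_linear_Re], of t]
        and I_Im = has_integral_linear[OF I bounded_linear_Im]
      have le: "\<bar>Im (quad_form (matrix_inv (?P + s *\<^sub>R ?Q)) x)\<bar> \<le> t * Re (quad_form (matrix_inv (?P + s *\<^sub>R ?Q)) x)"
        if "s \<in> {0<..}" for s
        using that by (intro sectorial_nonneg(2)[OF sectorial_matrix_inv] sectorial_add sectorial_scaleR
            sectorial_matrix_inv A B) auto
      have "Im (quad_form (geom_mean v A B) x) \<le> t * Re (quad_form (geom_mean v A B) x)"
        using I_Im I_Re
      proof (rule has_integral_le)
        fix s :: real assume "s \<in> {0<..}"
        from mult_left_mono[OF _ geom_weight_nonneg[OF v, of s], OF order_trans[OF abs_ge_self le[OF this]]]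
        show "(Im \<circ> (\<lambda>s. geom_weight v s *\<^sub>R quad_form (matrix_inv (?P + s *\<^sub>R ?Q)) x)) s
          \<le> t * (Re \<circ> (\<lambda>s. geom_weight v s *\<^sub>R quad_form (matrix_inv (?P + s *\<^sub>R ?Q)) x)) s"
          by (simp add: mult.left_commute)
      qed
      moreover have "- Im (quad_form (geom_mean v A B) x) \<le> t * Re (quad_form (geom_mean v A B) x)"
        using has_integral_neg[OF I_Im] I_Re
      proof (rule has_integral_le)
        fix s :: real assume "s \<in> {0<..}"
        from mult_left_mono[OF _ geom_weight_nonneg[OF v, of s], OF order_trans[OF abs_ge_minus_self le[OF this]]]
        show "- (Im \<circ> (\<lambda>s. geom_weight v s *\<^sub>R quad_form (matrix_inv (?P + s *\<^sub>R ?Q)) x)) s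
          \<le> t * (Re \<circ> (\<lambda>s. geom_weight v s *\<^sub>R quad_form (matrix_inv (?P + s *\<^sub>R ?Q)) x)) s"
          by (simp add: mult.left_commute)
      qed
      ultimately show "\<bar>Im (quad_form (geom_mean v A B) x)\<bar> \<le> t * Re (quad_form (geom_mean v A B) x)"
        by linarith
    qed
  qed
qed

section \<open>Comparison of the means\<close>

text \<open>The harmonic mean is \<open>S\<^sup>-\<^sup>1\<close> for \<open>S = (1 - v) A\<^sup>-\<^sup>1 + v
  B\<^sup>-\<^sup>1\<close>. The chord bound for the geometric mean is \<open>K(M/m)\<close> times the left-hand
  side of the tangent bound for \<open>S\<close> with \<open>\<tau> = 2 / (m + M)\<close>.\<close>

lemma quad_form_geom_le_harm:
  fixes A B :: "complex^'n^'n"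
  assumes A: "sectorial t A" and B: "sectorial t B" and t: "0 \<le> t" and v: "0 \<le> v" "v \<le> 1"
    and m: "0 < m" "m \<le> M"
    and PA: "\<And>x. m * (norm x)\<^sup>2 \<le> Re (quad_form (matrix_inv A) x)"
      "\<And>x. Re (quad_form (matrix_inv A) x) \<le> M * (norm x)\<^sup>2"
    and PB: "\<And>x. m * (norm x)\<^sup>2 \<le> Re (quad_form (matrix_inv B) x)"
      "\<And>x. Re (quad_form (matrix_inv B) x) \<le> M * (norm x)\<^sup>2"
  shows "Re (quad_form (geom_mean v A B) x)
    \<le> kantorovich (M / m) * ((1 + t\<^sup>2) * Re (quad_form (harm_mean v A B) x))"
proof -
  let ?S = "arith_mean v (matrix_inv A) (matrix_inv B)"
  define g s d where "g = Re (quad_form (geom_mean v A B) x)" and "s = Re (quad_form ?S x)"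
    and "d = (1 + t\<^sup>2) * Re (quad_form (harm_mean v A B) x)"
  have harm: "harm_mean v A B = matrix_inv ?S" by (simp add: harm_mean_def arith_mean_def)
  have S: "sectorial t ?S" by (intro sectorial_arith_mean sectorial_matrix_inv A B v)
  have K: "kantorovich (M / m) = (m + M)\<^sup>2 / (4 * (m * M))"
    using m by (simp add: kantorovich_def field_simps power2_eq_square)
  have scale: "k * n - s = k\<^sup>2 / 4 * (2 * (2 / k) * n - (2 / k)\<^sup>2 * s)" if "k \<noteq> 0" for k n :: real
    using that by (simp add: field_simps power2_eq_square)
  have "m * M * g \<le> (m + M) * (norm x)\<^sup>2 - s"
    unfolding g_def s_def quad_form_arith_mean
    by (rule geom_mean_upper_bound[OF A B v m PA PB])
  also have "\<dots> = (m + M)\<^sup>2 / 4 * (2 * (2 / (m + M)) * (norm x)\<^sup>2 - (2 / (m + M))\<^sup>2 * s)"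
    using m by (intro scale) simp
  also have "\<dots> \<le> (m + M)\<^sup>2 / 4 * d"
    using sectorial_inverse_lower_bound[OF S t, of "2 / (m + M)" x] unfolding d_def s_def harm
    by (intro mult_left_mono) auto
  finally have "g \<le> (m + M)\<^sup>2 / 4 * d / (m * M)"
    using m by (simp add: pos_le_divide_eq mult.commute)
  then show ?thesis by (simp add: K g_def d_def)
qed

text \<open>The tangent bound for the geometric mean contains the forms of \<open>A\<^sup>-\<^sup>1\<close> and
  \<open>B\<^sup>-\<^sup>1\<close>; the chord bound replaces them by those of \<open>A\<close> and
  \<open>B\<close>. For \<open>\<tau> = 2mM / (m + M)\<close> the terms in \<open>\<bar>x\<bar>\<^sup>2\<close>
  cancel and the form of the arithmetic mean remains with the factor \<open>\<tau>\<^sup>2 / (m M) = 1 /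
  K(M/m)\<close>.\<close>

lemma quad_form_arith_le_geom:
  fixes A B :: "complex^'n^'n"
  assumes A: "sectorial t A" and B: "sectorial t B" and t: "0 \<le> t" and v: "0 \<le> v" "v \<le> 1"
    and m: "0 < m" "m \<le> M"
    and bA: "\<And>x. m * (norm x)\<^sup>2 \<le> Re (quad_form A x)"
      "\<And>x. Re (quad_form A x) \<le> M * (norm x)\<^sup>2"
    and bB: "\<And>x. m * (norm x)\<^sup>2 \<le> Re (quad_form B x)"
      "\<And>x. Re (quad_form B x) \<le> M * (norm x)\<^sup>2"
  shows "Re (quad_form (arith_mean v A B) x)
    \<le> kantorovich (M / m) * ((1 + t\<^sup>2) * Re (quad_form (geom_mean v A B) x))"
proof -
  define a b e g where "a = Re (quad_form A x)" and "b = Re (quad_form B x)"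
    and "e = (1 - v) * Re (quad_form (matrix_inv A) x) + v * Re (quad_form (matrix_inv B) x)"
    and "g = (1 + t\<^sup>2) * Re (quad_form (geom_mean v A B) x)"
  define \<tau> where "\<tau> = 2 * (m * M) / (m + M)"
  have \<tau>: "\<tau> * (m + M) = 2 * (m * M)" using m by (simp add: \<tau>_def)
  have pos: "0 < m * M" using m by simp
  have K: "kantorovich (M / m) = (m * M) / \<tau>\<^sup>2"
    using m by (simp add: kantorovich_def \<tau>_def field_simps power2_eq_square)
  have "m * M * e = (1 - v) * (m * M * Re (quad_form (matrix_inv A) x)) + v * (m * M * Re (quad_form (matrix_inv B) x))"
    by (simp add: e_def algebra_simps)
  also have "\<dots> \<le> (1 - v) * ((m + M) * (norm x)\<^sup>2 - a) + v * ((m + M) * (norm x)\<^sup>2 - b)"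
    unfolding a_def b_def using v A B m bA bB
    by (intro add_mono mult_left_mono re_bounded_inverse_upper_bound sectorial_invertible[of t]) auto
  finally have "m * M * e \<le> (m + M) * (norm x)\<^sup>2 - ((1 - v) * a + v * b)" by (simp add: algebra_simps)
  then have "\<tau>\<^sup>2 * ((1 - v) * a + v * b) \<le> \<tau>\<^sup>2 * ((m + M) * (norm x)\<^sup>2 - m * M * e)"
    by (intro mult_left_mono) auto
  also have "\<dots> = \<tau> * (\<tau> * (m + M)) * (norm x)\<^sup>2 - m * M * \<tau>\<^sup>2 * e"
    by (simp add: power2_eq_square algebra_simps)
  also have "\<dots> = m * M * (2 * \<tau> * (norm x)\<^sup>2 - \<tau>\<^sup>2 * e)"
    unfolding \<tau> by (simp add: algebra_simps)
  also have "\<dots> \<le> m * M * g"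
    unfolding e_def g_def using pos by (intro mult_left_mono geom_mean_lower_bound[OF A B t v]) auto
  finally have "(1 - v) * a + v * b \<le> m * M * g / \<tau>\<^sup>2"
    using m by (simp add: pos_le_divide_eq mult.commute \<tau>_def)
  then show ?thesis by (simp add: K quad_form_arith_mean a_def b_def g_def)
qed

theorem corollary3p1:
  fixes A B :: "complex^'n^'n" and \<alpha> v m M h :: real
  assumes "0 \<le> \<alpha>" and "\<alpha> < pi / 2"
    and "0 \<le> v" and "v \<le> 1"
    and "0 < m" and "m \<le> M" and "h = M / m"
    and "numerical_range A \<subseteq> sector \<alpha>" and "numerical_range B \<subseteq> sector \<alpha>"
  shows "(mat (of_real m) \<le>\<^sub>L re_mat (matrix_inv A) \<and> re_mat (matrix_inv A) \<le>\<^sub>L mat (of_real M) \<and>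
          mat (of_real m) \<le>\<^sub>L re_mat (matrix_inv B) \<and> re_mat (matrix_inv B) \<le>\<^sub>L mat (of_real M) \<longrightarrow>
            cmod (det (geom_mean v A B))
              \<le> (1 / cos \<alpha>) ^ (5 * CARD('n)) * kantorovich h ^ CARD('n) * cmod (det (harm_mean v A B)))
       \<and> (mat (of_real m) \<le>\<^sub>L re_mat A \<and> re_mat A \<le>\<^sub>L mat (of_real M) \<and>
          mat (of_real m) \<le>\<^sub>L re_mat B \<and> re_mat B \<le>\<^sub>L mat (of_real M) \<longrightarrow>
            cmod (det (geom_mean v A B))
              \<ge> cos \<alpha> ^ (5 * CARD('n)) * kantorovich h powi (- int CARD('n)) * cmod (det (arith_mean v A B)))"
proof -
  define t where "t = tan \<alpha>"
  define c where "c = 1 / cos \<alpha>"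
  define K where "K = kantorovich h"
  have cos: "0 < cos \<alpha>" using assms by (intro cos_gt_zero_pi) auto
  have t: "0 \<le> t" using assms cos by (simp add: t_def tan_def sin_ge_zero)
  have c: "1 \<le> c" using cos by (simp add: c_def)
  have tc: "1 + t\<^sup>2 = c\<^sup>2"
    using cos tan_sec[of \<alpha>] by (simp add: t_def c_def inverse_eq_divide power_one_over)
  have sqrt: "sqrt (1 + t\<^sup>2) = c" using c tc by simp
  have h: "0 < h" using assms by simp
  have K: "0 < K" using h by (simp add: K_def kantorovich_def)
  have A: "sectorial t A" and B: "sectorial t B"
    unfolding t_def using assms by (auto intro: sectorial_of_numerical_range)
  note means = sectorial_geom_mean[OF A B t \<open>0 \<le> v\<close> \<open>v \<le> 1\<close>]
  have det_le: "cmod (det X) \<le> c ^ (5 * CARD('n)) * K ^ CARD('n) * cmod (det Y)"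
    if X: "sectorial t X" and Y: "sectorial t Y"
      and le: "\<And>x. Re (quad_form X x) \<le> K * ((1 + t\<^sup>2) * Re (quad_form Y x))" for X Y :: "complex^'n^'n"
  proof -
    \<comment> \<open>one factor \<open>c\<close> for passing from \<open>\<bar>x\<^sup>*Xx\<bar>\<close> to its real part, two from the hypothesis \<open>le\<close>\<close>
    have "cmod (det X) \<le> (c ^ 3 * K) ^ CARD('n) * cmod (det Y)"
    proof (rule cmod_det_le_of_quad_form_le)
      show "quad_form Y x \<noteq> 0" if "x \<noteq> 0" for x
        using Y that by (force simp: sectorial_def)
      fix x
      have "cmod (quad_form X x) \<le> c * Re (quad_form X x)"
        using sectorial_cmod_le[OF X t] by (simp add: sqrt)
      also have "\<dots> \<le> c * (K * (c\<^sup>2 * Re (quad_form Y x)))"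
        using le[of x] c by (intro mult_left_mono) (auto simp: tc)
      also have "\<dots> \<le> c * (K * (c\<^sup>2 * cmod (quad_form Y x)))"
        using c K by (intro mult_left_mono complex_Re_le_cmod) auto
      finally show "cmod (quad_form X x) \<le> c ^ 3 * K * cmod (quad_form Y x)"
        by (simp add: power2_eq_square power3_eq_cube mult_ac)
    qed
    also have "\<dots> = c ^ (3 * CARD('n)) * K ^ CARD('n) * cmod (det Y)"
      by (simp add: power_mult_distrib power_mult)
    also have "\<dots> \<le> c ^ (5 * CARD('n)) * K ^ CARD('n) * cmod (det Y)"
      using c K by (intro mult_right_mono power_increasing) auto
    finally show ?thesis .
  qed
  show ?thesis
  proof (intro conjI impI; elim conjE)
    assume *: "mat (of_real m) \<le>\<^sub>L re_mat (matrix_inv A)" "re_mat (matrix_inv A) \<le>\<^sub>L mat (of_real M)"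
      "mat (of_real m) \<le>\<^sub>L re_mat (matrix_inv B)" "re_mat (matrix_inv B) \<le>\<^sub>L mat (of_real M)"
    have "sectorial t (harm_mean v A B)"
      using sectorial_matrix_inv[OF sectorial_arith_mean[OF sectorial_matrix_inv[OF A] sectorial_matrix_inv[OF B]]] assms
      by (simp add: harm_mean_def arith_mean_def)
    then have "cmod (det (geom_mean v A B)) \<le> c ^ (5 * CARD('n)) * K ^ CARD('n) * cmod (det (harm_mean v A B))"
      using quad_form_geom_le_harm[OF A B t \<open>0 \<le> v\<close> \<open>v \<le> 1\<close> \<open>0 < m\<close> \<open>m \<le> M\<close>
          re_mat_lower_bound[OF *(1)] re_mat_upper_bound[OF *(2)] re_mat_lower_bound[OF *(3)] re_mat_upper_bound[OF *(4)]] means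
      by (intro det_le) (auto simp: K_def \<open>h = M / m\<close>)
    then show "cmod (det (geom_mean v A B))
        \<le> (1 / cos \<alpha>) ^ (5 * CARD('n)) * kantorovich h ^ CARD('n) * cmod (det (harm_mean v A B))"
      by (simp only: c_def K_def)
  next
    assume *: "mat (of_real m) \<le>\<^sub>L re_mat A" "re_mat A \<le>\<^sub>L mat (of_real M)"
      "mat (of_real m) \<le>\<^sub>L re_mat B" "re_mat B \<le>\<^sub>L mat (of_real M)"
    have "cmod (det (arith_mean v A B)) \<le> c ^ (5 * CARD('n)) * K ^ CARD('n) * cmod (det (geom_mean v A B))"
      using quad_form_arith_le_geom[OF A B t \<open>0 \<le> v\<close> \<open>v \<le> 1\<close> \<open>0 < m\<close> \<open>m \<le> M\<close>
          re_mat_lower_bound[OF *(1)] re_mat_upper_bound[OF *(2)] re_mat_lower_bound[OF *(3)] re_mat_upper_bound[OF *(4)]] means sectorial_arith_mean[OF A B] assms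
      by (intro det_le) (auto simp: K_def)
    then show "cos \<alpha> ^ (5 * CARD('n)) * kantorovich h powi (- int CARD('n)) * cmod (det (arith_mean v A B))
        \<le> cmod (det (geom_mean v A B))"
      using cos K by (simp add: c_def K_def power_int_minus power_one_over field_simps)
  qed
qed

end
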